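(* There exist finite sets $\mathcal{X},\mathcal{Y}$ and a two-party gadget $g\colon\mathcal{X}\times\mathcal{Y}\to\{0,1\}$ and an absolute constant $c>0$ such that for every $n$, every set $Q$ and every search problem $S\subseteq\{0,1\}^n\times Q$, the randomised bounded-error two-party communication complexity of the composed search problem $S\circ g^n$ is at least $c\cdot \mathrm{bs}_{\mathit{crit}}(S)$.
   Context: A search problem on $n$ variables is a relation $S\subseteq\{0,1\}^n\times Q$ such that every input $\alpha\in\{0,1\}^n$ has at least one feasible solution $q$ (i.e. $(\alpha,q)\in S$); the task on input $\alpha$ is to output a feasible $q$. An input is critical if it has a unique feasible solution. For a total function $f\colon\{0,1\}^n\to Q$ and $\alpha\in\{0,1\}^n$, $\mathrm{bs}(f,\alpha)$ is the maximum number $b$ of pairwise disjoint blocks $B_1,\dots,B_b\subseteq[n]$ with $f(\alpha^{B_i})\ne f(\alpha)$ for all $i$, where $\alpha^{B}$ is $\alpha$ with the bits in $B$ flipped. The critical block sensitivity is $\mathrm{bs}_{\mathit{crit}}(S)=\min_{f}\max_{\alpha\text{ critical}}\mathrm{bs}(f,\alpha)$, the minimum over all total functions $f$ with $(\alpha,f(\alpha))\in S$ for all $\alpha$. The composed problem $S\circ g^n$: Alice gets $x\in\mathcal{X}^n$, Bob gets $y\in\mathcal{Y}^n$, and they must output some $q$ with $((g(x_1,y_1),\dots,g(x_n,y_n)),q)\in S$. A randomised protocol solves a search problem with bounded error if on every input it outputs a feasible solution with probability at least $3/4$. *)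

theory Defs
  imports
    "HOL-Library.NList"
    "HOL-Library.Disjoint_Sets"
    "HOL-Probability.Probability_Mass_Function"
begin

section \<open>Search problems and critical block sensitivity\<close>

abbreviation cube :: "nat \<Rightarrow> bool list set" where
  "cube n \<equiv> nlists n UNIV"

definition search_problem :: "nat \<Rightarrow> 'q set \<Rightarrow> (bool list \<times> 'q) set \<Rightarrow> bool" where
  "search_problem n Q S \<longleftrightarrow> S \<subseteq> cube n \<times> Q \<and> (\<forall>\<alpha>\<in>cube n. \<exists>q. (\<alpha>, q) \<in> S)"

definition critical_inputs :: "nat \<Rightarrow> (bool list \<times> 'q) set \<Rightarrow> bool list set" where
  "critical_inputs n S = {\<alpha> \<in> cube n. \<exists>!q. (\<alpha>, q) \<in> S}"

definition flip :: "bool list \<Rightarrow> nat set \<Rightarrow> bool list" where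
  "flip \<alpha> B = map (\<lambda>i. if i \<in> B then \<not> \<alpha> ! i else \<alpha> ! i) [0..<length \<alpha>]"

text \<open>
  The set below contains \<open>0\<close> and is bounded by \<open>n\<close>: a block that changes the value of \<open>f\<close> is
  nonempty, and the blocks are pairwise disjoint.
\<close>

definition block_sensitivity :: "nat \<Rightarrow> (bool list \<Rightarrow> 'q) \<Rightarrow> bool list \<Rightarrow> nat" where
  "block_sensitivity n f \<alpha> =
     Max {b. \<exists>B :: nat \<Rightarrow> nat set.
            (\<forall>i<b. B i \<subseteq> {..<n} \<and> f (flip \<alpha> (B i)) \<noteq> f \<alpha>) \<and>
            disjoint_family_on B {..<b}}"

definition solving_functions :: "nat \<Rightarrow> (bool list \<times> 'q) set \<Rightarrow> (bool list \<Rightarrow> 'q) set" where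
  "solving_functions n S = {f. \<forall>\<alpha>\<in>cube n. (\<alpha>, f \<alpha>) \<in> S}"

text \<open>
  For a search problem both bounds are attained, except that the supremum over an empty set of
  critical inputs is \<open>0\<close>. Only the values of \<open>f\<close> on the cube matter.
\<close>

definition critical_block_sensitivity :: "nat \<Rightarrow> (bool list \<times> 'q) set \<Rightarrow> nat" where
  "critical_block_sensitivity n S =
     (INF f\<in>solving_functions n S. SUP \<alpha>\<in>critical_inputs n S. block_sensitivity n f \<alpha>)"


section \<open>Two-party communication\<close>

text \<open>
  Deterministic protocols are binary trees. At an inner node the owner sends one bit depending on
  their own input: \<open>True\<close> leads to the first subtree, \<open>False\<close> to the second.
\<close>

datatype ('x, 'y, 'q) protocol =
    Output 'q
  | Alice "'x \<Rightarrow> bool" "('x, 'y, 'q) protocol" "('x, 'y, 'q) protocol"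
  | Bob "'y \<Rightarrow> bool" "('x, 'y, 'q) protocol" "('x, 'y, 'q) protocol"

primrec run :: "('x, 'y, 'q) protocol \<Rightarrow> 'x \<Rightarrow> 'y \<Rightarrow> 'q" where
  "run (Output q) x y = q"
| "run (Alice a P P') x y = (if a x then run P x y else run P' x y)"
| "run (Bob b P P') x y = (if b y then run P x y else run P' x y)"

primrec cost :: "('x, 'y, 'q) protocol \<Rightarrow> nat" where
  "cost (Output q) = 0"
| "cost (Alice a P P') = Suc (max (cost P) (cost P'))"
| "cost (Bob b P P') = Suc (max (cost P) (cost P'))"

text \<open>
  A randomised protocol uses public coins, i.e. it is a probability distribution over
  deterministic protocols. Its cost is the worst case over coins and inputs.
  A two-party search problem on inputs \<open>A \<times> B\<close> is a relation \<open>T\<close> between input pairs and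
  solutions.
\<close>

definition solves_with_bounded_error ::
    "('x, 'y, 'q) protocol pmf \<Rightarrow> 'x set \<Rightarrow> 'y set \<Rightarrow> (('x \<times> 'y) \<times> 'q) set \<Rightarrow> bool" where
  "solves_with_bounded_error R A B T \<longleftrightarrow>
     (\<forall>x\<in>A. \<forall>y\<in>B. measure_pmf.prob R {P. ((x, y), run P x y) \<in> T} \<ge> 3 / 4)"

text \<open>
  If \<open>A\<close> and \<open>B\<close> are finite and every input pair has a solution, the infimum is over a nonempty
  set and hence attained.
\<close>

definition randomised_cc :: "'x set \<Rightarrow> 'y set \<Rightarrow> (('x \<times> 'y) \<times> 'q) set \<Rightarrow> nat" where
  "randomised_cc A B T =
     Inf {d. \<exists>R. (\<forall>P\<in>set_pmf R. cost P \<le> d) \<and> solves_with_bounded_error R A B T}"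

definition composed ::
    "nat \<Rightarrow> 'x set \<Rightarrow> 'y set \<Rightarrow> ('x \<Rightarrow> 'y \<Rightarrow> bool) \<Rightarrow> (bool list \<times> 'q) set
      \<Rightarrow> (('x list \<times> 'y list) \<times> 'q) set" where
  "composed n X Y g S =
     {((x, y), q). x \<in> nlists n X \<and> y \<in> nlists n Y \<and> (map2 g x y, q) \<in> S}"

definition composed_cc ::
    "nat \<Rightarrow> 'x set \<Rightarrow> 'y set \<Rightarrow> ('x \<Rightarrow> 'y \<Rightarrow> bool) \<Rightarrow> (bool list \<times> 'q) set \<Rightarrow> nat" where
  "composed_cc n X Y g S =
     randomised_cc (nlists n X) (nlists n Y) (composed n X Y g S)"

text \<open>
  The lower bound for all search problems whose solutions are drawn from the type \<open>'q\<close>; the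
  type argument makes explicit that neither the gadget nor the constant is tied to that type.
\<close>

definition critical_bs_lower_bound ::
    "'q itself \<Rightarrow> 'x set \<Rightarrow> 'y set \<Rightarrow> ('x \<Rightarrow> 'y \<Rightarrow> bool) \<Rightarrow> real \<Rightarrow> bool" where
  "critical_bs_lower_bound (_ :: 'q itself) X Y g c \<longleftrightarrow>
     (\<forall>n (Q :: 'q set) S. search_problem n Q S \<longrightarrow>
        real (composed_cc n X Y g S) \<ge> c * real (critical_block_sensitivity n S))"

end

(* A protocol for the composed problem induces the function f that maps z to the feasible solution
   that the protocol outputs with probability above 1/2 on a random encoding of z, if there is one.
   At a critical input z with sensitive blocks B_1, ..., B_b the value f z is output with probability
   at least 3/4 on encodings of z, but at most 1/2 on encodings of z flipped at B_i. The gadget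
   (x + y) mod 4 >= 2 is randomly self-reducible, contains AND and can be negated locally. So the
   protocol distinguishes disjoint from uniquely intersecting pairs of subsets of {1, ..., b}.

   This needs cost of order b. Draw T uniformly, then u from the subsets of T and v from those of its
   complement, so that each leaf rectangle A x B becomes a product given T. The leaf can tell
   intersection at i from disjointness only through the correlation of A or B with the sign of
   coordinate i. By an exponential moment bound for signed sums these correlations, summed over i, are
   at most (l^2 b + k)/l on average over the at most 2^k leaves, for every l between 0 and 1. *)
theory Submission
  imports Defs
begin

section \<open>Sums over subsets and exponential moments\<close>

lemma sum_Pow_remove:
  fixes h :: "'a set \<Rightarrow> real"
  assumes "finite T" "i \<in> T"
  shows "(\<Sum>u\<in>Pow T. h u) = (\<Sum>u\<in>Pow (T - {i}). h u + h (insert i u))"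
proof -
  have inj: "inj_on (insert i) (Pow (T - {i}))"
    by (auto simp: inj_on_def)
  have "Pow T = Pow (T - {i}) \<union> insert i ` Pow (T - {i})"
    using Pow_insert[of i "T - {i}"] assms(2) by (simp add: insert_absorb)
  then have "(\<Sum>u\<in>Pow T. h u) = (\<Sum>u\<in>Pow (T - {i}). h u) + (\<Sum>u\<in>insert i ` Pow (T - {i}). h u)"
    using assms(1) by (auto intro!: sum.union_disjoint)
  then show ?thesis
    using inj by (simp add: sum.reindex sum.distrib)
qed

lemma sum_Pow_insert:
  fixes h :: "'a set \<Rightarrow> real"
  assumes "finite T" "i \<notin> T"
  shows "(\<Sum>u\<in>Pow (insert i T). h u) = (\<Sum>u\<in>Pow T. h u) + (\<Sum>u\<in>Pow T. h (insert i u))"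
  using sum_Pow_remove[of "insert i T" i h] assms by (simp add: sum.distrib)

lemma sum_Pow_complement:
  fixes h :: "'a set \<Rightarrow> real"
  shows "(\<Sum>T\<in>Pow I. h (I - T)) = (\<Sum>T\<in>Pow I. h T)"
  by (rule sum.reindex_bij_witness[where i = "\<lambda>T. I - T" and j = "\<lambda>T. I - T"]) auto

text \<open>Both sides count the pairs \<open>i \<in> T\<close>, with \<open>s = T - {i}\<close>.
  This turns a fixed coordinate together with a split of the others into a split \<open>T\<close>
  together with a sum over its coordinates.\<close>

lemma sum_insert_swap:
  fixes F :: "'a set \<Rightarrow> 'a \<Rightarrow> real"
  assumes "finite I"
  shows "(\<Sum>i\<in>I. \<Sum>s\<in>Pow (I - {i}). F (insert i s) i) = (\<Sum>T\<in>Pow I. \<Sum>i\<in>T. F T i)"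
proof -
  have "(\<Sum>i\<in>I. \<Sum>s\<in>Pow (I - {i}). F (insert i s) i)
      = (\<Sum>(i, s)\<in>Sigma I (\<lambda>i. Pow (I - {i})). F (insert i s) i)"
    using assms by (simp add: sum.Sigma)
  also have "\<dots> = (\<Sum>(T, i)\<in>Sigma (Pow I) (\<lambda>T. T). F T i)"
    by (rule sum.reindex_bij_witness[where i = "\<lambda>(T, i). (i, T - {i})"
          and j = "\<lambda>(i, s). (insert i s, i)"]) auto
  also have "\<dots> = (\<Sum>T\<in>Pow I. \<Sum>i\<in>T. F T i)"
    using assms by (subst sum.Sigma) (auto intro: finite_subset)
  finally show ?thesis .
qed

text \<open>The bound cosh x \<le> exp (x^2 / 2) with a weaker constant, obtained from quadratic
  bounds on \<open>exp x\<close> and \<open>exp (- x)\<close>.\<close>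

lemma exp_plus_exp_minus_le:
  fixes x :: real
  assumes "0 \<le> x" "x \<le> 1"
  shows "exp x + exp (- x) \<le> 2 * exp (x\<^sup>2)"
proof -
  \<comment> \<open>The product equals 1 + x^3.\<close>
  have "1 \<le> (1 + x) * (1 - x + x\<^sup>2)"
    using assms by (simp add: algebra_simps power2_eq_square)
  also have "\<dots> \<le> exp x * (1 - x + x\<^sup>2)"
    using assms exp_ge_add_one_self[of x] by (intro mult_right_mono) auto
  finally have "exp (- x) \<le> 1 - x + x\<^sup>2"
    by (simp add: exp_minus field_simps)
  moreover have "exp x \<le> 1 + x + x\<^sup>2"
    using exp_bound[of x] assms by simp
  ultimately show ?thesis
    using exp_ge_add_one_self[of "x\<^sup>2"] by linarith
qed

text \<open>The sum over \<open>u\<close> factorises into one factor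
  \<open>exp l + exp (- l)\<close> per coordinate, whatever the signs are.\<close>

lemma sum_Pow_exp_signed:
  fixes l :: real and \<sigma> :: "'a \<Rightarrow> real"
  assumes "finite T" "0 \<le> l" "l \<le> 1" "\<And>i. i \<in> T \<Longrightarrow> \<sigma> i = 1 \<or> \<sigma> i = -1"
  shows "(\<Sum>u\<in>Pow T. exp (l * (\<Sum>i\<in>T. if i \<in> u then - \<sigma> i else \<sigma> i)))
    \<le> (2 * exp (l\<^sup>2)) ^ card T"
proof -
  have "exp (l * (\<Sum>i\<in>T. if i \<in> u then - \<sigma> i else \<sigma> i))
      = (\<Prod>i\<in>u. exp (- l * \<sigma> i)) * (\<Prod>i\<in>T - u. exp (l * \<sigma> i))" if "u \<in> Pow T" for u
  proof -
    have "(\<Sum>i\<in>T. if i \<in> u then - \<sigma> i else \<sigma> i) = (\<Sum>i\<in>T \<inter> u. - \<sigma> i) + (\<Sum>i\<in>T - u. \<sigma> i)"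
      using sum.If_cases[OF assms(1), of "\<lambda>i. i \<in> u" "\<lambda>i. - \<sigma> i" \<sigma>]
      by (simp add: Diff_eq Collect_neg_eq)
    moreover have "T \<inter> u = u" "finite u"
      using that assms(1) finite_subset by auto
    ultimately show ?thesis
      using assms(1)
      by (simp add: sum_negf right_diff_distrib flip: exp_sum exp_add sum_distrib_left)
  qed
  then have "(\<Sum>u\<in>Pow T. exp (l * (\<Sum>i\<in>T. if i \<in> u then - \<sigma> i else \<sigma> i)))
      = (\<Prod>i\<in>T. exp (- l * \<sigma> i) + exp (l * \<sigma> i))"
    using prod_add[OF assms(1), of "\<lambda>i. exp (- l * \<sigma> i)" "\<lambda>i. exp (l * \<sigma> i)"] by simp
  also have "\<dots> \<le> (\<Prod>i\<in>T. 2 * exp (l\<^sup>2))"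
  proof (rule prod_mono)
    fix i assume "i \<in> T"
    then show "0 \<le> exp (- l * \<sigma> i) + exp (l * \<sigma> i)
        \<and> exp (- l * \<sigma> i) + exp (l * \<sigma> i) \<le> 2 * exp (l\<^sup>2)"
      using assms(4)[of i] exp_plus_exp_minus_le[OF assms(2,3)] by (auto simp: add_nonneg_nonneg)
  qed
  finally show ?thesis
    by simp
qed

section \<open>Corruption of rectangles\<close>

text \<open>For finite \<open>T\<close> and \<open>i \<in> T\<close>, this is the absolute value of
  the Fourier coefficient of \<open>A\<close> at \<open>{i}\<close> over the subsets of
  \<open>T\<close>, scaled by \<open>2 ^ card T\<close>.\<close>

definition influence :: "('a set \<Rightarrow> real) \<Rightarrow> 'a set \<Rightarrow> 'a \<Rightarrow> real" where
  "influence A T i = \<bar>\<Sum>u\<in>Pow (T - {i}). A u - A (insert i u)\<bar>"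

lemma influence_nonneg: "0 \<le> influence A T i"
  by (simp add: influence_def)

text \<open>A level-one inequality: for suitable signs \<sigma> the influences add up to an
  \<open>A\<close>-weighted sum of the signed sums \<open>L u\<close>, whose exponential moment is
  small. The parameter \<open>c\<close> balances the two terms and is chosen later.\<close>

lemma sum_influence_le:
  fixes l c :: real
  assumes "finite T" "0 \<le> l" "l \<le> 1" "\<And>u. 0 \<le> A u" "\<And>u. A u \<le> 1"
  shows "l * (\<Sum>i\<in>T. influence A T i)
    \<le> exp (- c) * (2 * exp (l\<^sup>2)) ^ card T + (c - 1) * (\<Sum>u\<in>Pow T. A u)"
proof -
  define \<sigma> :: "'a \<Rightarrow> real"
    where "\<sigma> i = (if (\<Sum>u\<in>Pow (T - {i}). A u - A (insert i u)) \<ge> 0 then 1 else - 1)" for i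
  define L where "L u = (\<Sum>i\<in>T. if i \<in> u then - \<sigma> i else \<sigma> i)" for u
  have inf: "influence A T i = (\<Sum>u\<in>Pow T. A u * (if i \<in> u then - \<sigma> i else \<sigma> i))"
    if "i \<in> T" for i
  proof -
    have "(\<Sum>u\<in>Pow T. A u * (if i \<in> u then - \<sigma> i else \<sigma> i))
        = (\<Sum>u\<in>Pow (T - {i}). \<sigma> i * (A u - A (insert i u)))"
      by (subst sum_Pow_remove[OF assms(1) that])
         (auto intro!: sum.cong simp: algebra_simps)
    also have "\<dots> = \<sigma> i * (\<Sum>u\<in>Pow (T - {i}). A u - A (insert i u))"
      by (simp add: sum_distrib_left)
    finally show ?thesis
      by (simp add: influence_def \<sigma>_def)
  qed
  have "l * (\<Sum>i\<in>T. influence A T i) = (\<Sum>u\<in>Pow T. A u * (l * L u))"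
  proof -
    have "(\<Sum>i\<in>T. influence A T i) = (\<Sum>u\<in>Pow T. A u * L u)"
      unfolding L_def sum_distrib_left by (subst sum.swap) (simp add: inf)
    then show ?thesis
      by (simp add: sum_distrib_left mult_ac)
  qed
  also have "\<dots> \<le> (\<Sum>u\<in>Pow T. exp (- c) * exp (l * L u) + (c - 1) * A u)"
    \<comment> \<open>the tangent inequality \<open>x \<le> exp (x - c) + c - 1\<close>, with \<open>A u\<close> dropped from the exponential part\<close>
  proof (rule sum_mono)
    fix u
    have "l * L u \<le> exp (l * L u - c) + (c - 1)"
      using exp_ge_add_one_self[of "l * L u - c"] by linarith
    then have "A u * (l * L u) \<le> A u * (exp (l * L u - c) + (c - 1))"
      using assms(4) by (rule mult_left_mono)
    also have "\<dots> \<le> exp (l * L u - c) + (c - 1) * A u"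
      using mult_right_mono[OF assms(5)[of u], of "exp (l * L u - c)"] by (simp add: algebra_simps)
    finally show "A u * (l * L u) \<le> exp (- c) * exp (l * L u) + (c - 1) * A u"
      by (simp add: exp_diff exp_minus divide_inverse mult.commute)
  qed
  also have "\<dots> = exp (- c) * (\<Sum>u\<in>Pow T. exp (l * L u)) + (c - 1) * (\<Sum>u\<in>Pow T. A u)"
    by (simp add: sum.distrib sum_distrib_left)
  also have "\<dots> \<le> exp (- c) * (2 * exp (l\<^sup>2)) ^ card T + (c - 1) * (\<Sum>u\<in>Pow T. A u)"
    unfolding L_def using sum_Pow_exp_signed[OF assms(1-3), of \<sigma>]
    by (intro add_right_mono mult_left_mono) (auto simp: \<sigma>_def)
  finally show ?thesis .
qed

text \<open>
  Up to the factors \<open>4 ^ card I\<close> and \<open>4 ^ (card I - 1)\<close>, these are the averages of \<open>G\<close> over random disjoint pairs and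
  random pairs that intersect exactly in \<open>i\<close>; \<open>T\<close> and \<open>s\<close> are the coordinates where only the first
  set is free.
\<close>

definition disjoint_sum :: "'a set \<Rightarrow> ('a set \<Rightarrow> 'a set \<Rightarrow> real) \<Rightarrow> real" where
  "disjoint_sum I G = (\<Sum>T\<in>Pow I. \<Sum>u\<in>Pow T. \<Sum>v\<in>Pow (I - T). G u v)"

definition intersecting_sum :: "'a set \<Rightarrow> 'a \<Rightarrow> ('a set \<Rightarrow> 'a set \<Rightarrow> real) \<Rightarrow> real" where
  "intersecting_sum I i G =
     (\<Sum>s\<in>Pow (I - {i}). \<Sum>u\<in>Pow s. \<Sum>v\<in>Pow (I - {i} - s). G (insert i u) (insert i v))"

text \<open>The factor 4 equalises the total weights of the two sums. A constant \<open>G\<close>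
  thus has corruption 0, and a large value means that \<open>G\<close> favours disjoint
  pairs.\<close>

definition corruption :: "'a set \<Rightarrow> ('a set \<Rightarrow> 'a set \<Rightarrow> real) \<Rightarrow> real" where
  "corruption I G = (\<Sum>i\<in>I. disjoint_sum I G - 4 * intersecting_sum I i G)"

lemma disjoint_sum_add:
  "disjoint_sum I (\<lambda>u v. G u v + H u v) = disjoint_sum I G + disjoint_sum I H"
  by (simp add: disjoint_sum_def sum.distrib)

lemma corruption_add:
  "corruption I (\<lambda>u v. G u v + H u v) = corruption I G + corruption I H"
  by (simp add: corruption_def disjoint_sum_add intersecting_sum_def sum.distrib sum_subtractf
      algebra_simps)

lemma disjoint_sum_product:
  "disjoint_sum I (\<lambda>u v. A u * B v)
    = (\<Sum>T\<in>Pow I. (\<Sum>u\<in>Pow T. A u) * (\<Sum>v\<in>Pow (I - T). B v))"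
  by (simp add: disjoint_sum_def sum_product)

lemma disjoint_sum_const:
  assumes "finite I"
  shows "disjoint_sum I (\<lambda>u v. r) = r * 4 ^ card I"
proof -
  have "(\<Sum>u\<in>Pow T. \<Sum>v\<in>Pow (I - T). r) = r * 2 ^ card I" if "T \<in> Pow I" for T
  proof -
    have "finite T" "card T + card (I - T) = card I"
      using that assms finite_subset[of T I] card_mono[of I T]
      by (auto simp: card_Diff_subset)
    then show ?thesis
      using assms by (simp add: card_Pow flip: power_add)
  qed
  then have "disjoint_sum I (\<lambda>u v. r) = (\<Sum>T\<in>Pow I. r * 2 ^ card I)"
    unfolding disjoint_sum_def by (rule sum.cong[OF refl])
  also have "\<dots> = r * (2 * 2) ^ card I"
    using assms unfolding power_mult_distrib by (simp add: card_Pow)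
  finally show ?thesis
    by simp
qed

lemma intersecting_sum_const:
  assumes "finite I" "i \<in> I"
  shows "4 * intersecting_sum I i (\<lambda>u v. r) = r * 4 ^ card I"
proof -
  have "4 * intersecting_sum I i (\<lambda>u v. r) = 4 * disjoint_sum (I - {i}) (\<lambda>u v. r)"
    by (simp add: intersecting_sum_def disjoint_sum_def)
  also have "\<dots> = r * 4 ^ Suc (card (I - {i}))"
    using assms by (subst disjoint_sum_const) auto
  also have "\<dots> = r * 4 ^ card I"
    using assms by (simp only: card_Suc_Diff1)
  finally show ?thesis .
qed

text \<open>The indices 0 and 1 stand for sets without and with \<open>i\<close>. The first two
  products count disjoint pairs with \<open>i\<close> free on either side, \<open>a1 * b1\<close>
  counts pairs that meet in \<open>i\<close>. Each difference on the right has weight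
  \<open>b0\<close> or \<open>a0\<close>, because the other set must avoid \<open>i\<close>.\<close>

lemma corruption_inequality:
  fixes a0 a1 b0 b1 :: real
  assumes "0 \<le> a0" "0 \<le> a1" "0 \<le> b0" "0 \<le> b1"
  shows "(a0 + a1) * b0 + a0 * (b0 + b1) - 4 * (a1 * b1)
    \<le> 5 * (\<bar>a0 - a1\<bar> * b0 + a0 * \<bar>b0 - b1\<bar>)"
proof -
  have *: "a0 * b0 - a1 * b1 \<le> \<bar>a0 - a1\<bar> * b0 + a0 * \<bar>b0 - b1\<bar>"
  proof (cases "a1 \<le> a0 \<or> b1 \<le> b0")
    case True
    then consider "a1 \<le> a0" "b1 \<le> b0" | "a1 \<le> a0" "b0 \<le> b1" | "a0 \<le> a1" "b1 \<le> b0"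
      by linarith
    then show ?thesis
    proof cases
      case 1
      then have "0 \<le> (a0 - a1) * (b0 - b1)" by simp
      then show ?thesis using 1 by (simp add: algebra_simps)
    next
      case 2
      then have "a1 * b0 \<le> a1 * b1" using assms by (simp add: mult_left_mono)
      moreover have "0 \<le> a0 * (b1 - b0)" using 2 assms by simp
      ultimately show ?thesis using 2 by (simp add: algebra_simps)
    next
      case 3
      then have "a0 * b1 \<le> a1 * b1" using assms by (simp add: mult_right_mono)
      moreover have "0 \<le> (a1 - a0) * b0" using 3 assms by simp
      ultimately show ?thesis using 3 by (simp add: algebra_simps)
    qed
  next
    case False
    then have "a0 * b0 \<le> a1 * b1" using assms by (intro mult_mono) auto
    moreover have "0 \<le> \<bar>a0 - a1\<bar> * b0 + a0 * \<bar>b0 - b1\<bar>" using assms by simp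
    ultimately show ?thesis by linarith
  qed
  \<comment> \<open>The left-hand side of the goal is
    \<open>4 * (a0 * b0 - a1 * b1) + (a1 - a0) * b0 + a0 * (b1 - b0)\<close>, which gives 5 = 4 +
    1.\<close>
  have "(a1 - a0) * b0 \<le> \<bar>a0 - a1\<bar> * b0" "a0 * (b1 - b0) \<le> a0 * \<bar>b0 - b1\<bar>"
    using assms by (auto intro!: mult_right_mono mult_left_mono)
  then show ?thesis
    using * by (simp add: algebra_simps)
qed

text \<open>Given a split of the coordinates other than \<open>i\<close>, a rectangle becomes a
  product, so \<open>corruption_inequality\<close> applies to each split. Regrouping by
  \<open>T = insert i s\<close> then collects the influences over one \<open>T\<close>.\<close>

lemma corruption_rectangle_le:
  fixes A B :: "'a set \<Rightarrow> real"
  assumes "finite I" and A: "\<And>u. 0 \<le> A u" and B: "\<And>v. 0 \<le> B v"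
  shows "corruption I (\<lambda>u v. A u * B v)
    \<le> 5 * (\<Sum>T\<in>Pow I. (\<Sum>i\<in>T. influence A T i) * (\<Sum>v\<in>Pow (I - T). B v)
          + (\<Sum>u\<in>Pow (I - T). A u) * (\<Sum>i\<in>T. influence B T i))"
proof -
  define a where "a T = (\<Sum>u\<in>Pow T. A u)" for T
  define b where "b T = (\<Sum>v\<in>Pow T. B v)" for T
  have one: "disjoint_sum I (\<lambda>u v. A u * B v) - 4 * intersecting_sum I i (\<lambda>u v. A u * B v)
      \<le> 5 * (\<Sum>s\<in>Pow (I - {i}). influence A (insert i s) i * b (I - insert i s)
             + a (I - insert i s) * influence B (insert i s) i)" if "i \<in> I" for i
  proof -
    define J where "J = I - {i}"
    have J: "finite J" "i \<notin> J" "I = insert i J"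
      using assms(1) that by (auto simp: J_def)
    define a' where "a' s = (\<Sum>u\<in>Pow s. A (insert i u))" for s
    define b' where "b' s = (\<Sum>v\<in>Pow s. B (insert i v))" for s
    have inf: "influence A (insert i s) i = \<bar>a s - a' s\<bar>"
              "influence B (insert i s) i = \<bar>b s - b' s\<bar>"
              "a (insert i s) = a s + a' s" "b (insert i s) = b s + b' s"
      if "s \<in> Pow J" for s
    proof -
      have "finite s" "i \<notin> s" "insert i s - {i} = s"
        using that J finite_subset by auto
      then show "influence A (insert i s) i = \<bar>a s - a' s\<bar>"
              "influence B (insert i s) i = \<bar>b s - b' s\<bar>"
              "a (insert i s) = a s + a' s" "b (insert i s) = b s + b' s"
        by (simp_all add: influence_def a_def a'_def b_def b'_def sum_subtractf sum_Pow_insert)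
    qed
    have D: "disjoint_sum I (\<lambda>u v. A u * B v)
        = (\<Sum>s\<in>Pow J. (a s + a' s) * b (J - s) + a s * (b (J - s) + b' (J - s)))"
    proof -
      have "disjoint_sum I (\<lambda>u v. A u * B v) = (\<Sum>T\<in>Pow (insert i J). a T * b (I - T))"
        by (simp add: disjoint_sum_product a_def b_def J(3))
      also have "\<dots> = (\<Sum>s\<in>Pow J. a s * b (I - s)) + (\<Sum>s\<in>Pow J. a (insert i s) * b (I - insert i s))"
        using J by (simp add: sum_Pow_insert)
      also have "(\<Sum>s\<in>Pow J. a s * b (I - s)) = (\<Sum>s\<in>Pow J. a s * (b (J - s) + b' (J - s)))"
      proof (rule sum.cong)
        fix s assume s: "s \<in> Pow J"
        then have "I - s = insert i (J - s)" "J - s \<in> Pow J" using J by auto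
        then show "a s * b (I - s) = a s * (b (J - s) + b' (J - s))"
          using inf(4)[of "J - s"] by simp
      qed simp
      also have "(\<Sum>s\<in>Pow J. a (insert i s) * b (I - insert i s)) = (\<Sum>s\<in>Pow J. (a s + a' s) * b (J - s))"
      proof (rule sum.cong)
        fix s assume s: "s \<in> Pow J"
        then have "I - insert i s = J - s" using J by auto
        then show "a (insert i s) * b (I - insert i s) = (a s + a' s) * b (J - s)"
          using inf(3)[OF s] by simp
      qed simp
      finally show ?thesis
        by (simp add: sum.distrib add.commute)
    qed
    have U: "intersecting_sum I i (\<lambda>u v. A u * B v) = (\<Sum>s\<in>Pow J. a' s * b' (J - s))"
      by (simp add: intersecting_sum_def a'_def b'_def J_def sum_product)
    have "disjoint_sum I (\<lambda>u v. A u * B v) - 4 * intersecting_sum I i (\<lambda>u v. A u * B v)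
        = (\<Sum>s\<in>Pow J. (a s + a' s) * b (J - s) + a s * (b (J - s) + b' (J - s)) - 4 * (a' s * b' (J - s)))"
      by (simp add: D U sum_subtractf sum_distrib_left)
    also have "\<dots> \<le> (\<Sum>s\<in>Pow J. 5 * (\<bar>a s - a' s\<bar> * b (J - s) + a s * \<bar>b (J - s) - b' (J - s)\<bar>))"
      by (intro sum_mono corruption_inequality)
         (auto simp: a_def b_def a'_def b'_def A B intro!: sum_nonneg)
    also have "\<dots> = 5 * ((\<Sum>s\<in>Pow J. \<bar>a s - a' s\<bar> * b (J - s)) + (\<Sum>s\<in>Pow J. a s * \<bar>b (J - s) - b' (J - s)\<bar>))"
      by (simp add: sum_distrib_left sum.distrib distrib_left)
    \<comment> \<open>After complementing within \<open>J\<close>, \<open>insert i s\<close> is in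
      both sums the domain of the set whose influence is measured.\<close>
    also have "(\<Sum>s\<in>Pow J. a s * \<bar>b (J - s) - b' (J - s)\<bar>) = (\<Sum>s\<in>Pow J. a (J - s) * \<bar>b s - b' s\<bar>)"
    proof -
      have "(\<Sum>s\<in>Pow J. a s * \<bar>b (J - s) - b' (J - s)\<bar>)
          = (\<Sum>s\<in>Pow J. a (J - s) * \<bar>b (J - (J - s)) - b' (J - (J - s))\<bar>)"
        by (rule sum_Pow_complement[symmetric])
      also have "\<dots> = (\<Sum>s\<in>Pow J. a (J - s) * \<bar>b s - b' s\<bar>)"
        by (rule sum.cong) (simp_all add: double_diff)
      finally show ?thesis .
    qed
    also have "5 * ((\<Sum>s\<in>Pow J. \<bar>a s - a' s\<bar> * b (J - s)) + (\<Sum>s\<in>Pow J. a (J - s) * \<bar>b s - b' s\<bar>))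
        = 5 * (\<Sum>s\<in>Pow J. influence A (insert i s) i * b (I - insert i s)
             + a (I - insert i s) * influence B (insert i s) i)"
    proof -
      have "I - insert i s = J - s" for s by (auto simp: J_def)
      then show ?thesis
        using inf by (simp add: sum.distrib[symmetric])
    qed
    finally show ?thesis by (simp add: J_def)
  qed
  have "corruption I (\<lambda>u v. A u * B v)
      \<le> (\<Sum>i\<in>I. 5 * (\<Sum>s\<in>Pow (I - {i}). influence A (insert i s) i * b (I - insert i s)
             + a (I - insert i s) * influence B (insert i s) i))"
    unfolding corruption_def by (intro sum_mono one)
  also have "\<dots> = 5 * (\<Sum>T\<in>Pow I. \<Sum>i\<in>T. influence A T i * b (I - T) + a (I - T) * influence B T i)"
    using sum_insert_swap[OF assms(1), of "\<lambda>T i. influence A T i * b (I - T) + a (I - T) * influence B T i"]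
    by (simp add: sum_distrib_left[symmetric])
  finally show ?thesis
    by (simp only: a_def b_def sum.distrib sum_distrib_left[symmetric] sum_distrib_right[symmetric])
qed

text \<open>In \<open>sum_influence_le\<close>, \<open>c\<close> is chosen so that the exponential
  term is at most \<open>2 ^ card T * exp (- L)\<close>. That term will be paid once per leaf,
  whereas the other one is proportional to the mass of the rectangle and hence additive over
  leaves.\<close>

lemma influence_rectangle_le:
  fixes A B :: "'a set \<Rightarrow> real"
  assumes "finite I" "0 \<le> l" "l \<le> 1"
    and A: "\<And>u. 0 \<le> A u" "\<And>u. A u \<le> 1" and B: "\<And>v. 0 \<le> B v" "\<And>v. B v \<le> 1"
  shows "l * (\<Sum>T\<in>Pow I. (\<Sum>i\<in>T. influence A T i) * (\<Sum>v\<in>Pow (I - T). B v))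
    \<le> 4 ^ card I * exp (- L)
        + (l\<^sup>2 * card I + L - 1) * (\<Sum>T\<in>Pow I. (\<Sum>u\<in>Pow T. A u) * (\<Sum>v\<in>Pow (I - T). B v))"
proof -
  define c where "c = l\<^sup>2 * card I + L"
  define a where "a T = (\<Sum>u\<in>Pow T. A u)" for T
  define b where "b T = (\<Sum>v\<in>Pow T. B v)" for T
  have "l * (\<Sum>i\<in>T. influence A T i) * b (I - T) \<le> 2 ^ card I * exp (- L) + (c - 1) * (a T * b (I - T))"
    if "T \<in> Pow I" for T
  proof -
    have T: "finite T" "T \<subseteq> I" "card T \<le> card I"
      using that assms(1) by (auto intro: finite_subset card_mono)
    have b: "0 \<le> b (I - T)" "b (I - T) \<le> 2 ^ card (I - T)"
      using assms(1) B sum_bounded_above[of "Pow (I - T)" B 1] by (auto simp: b_def card_Pow sum_nonneg)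
    have "exp (- c) * (2 * exp (l\<^sup>2)) ^ card T = 2 ^ card T * exp (l\<^sup>2 * card T - c)"
      by (simp add: power_mult_distrib exp_diff exp_minus divide_inverse exp_of_nat_mult[symmetric] mult_ac)
    also have "\<dots> \<le> 2 ^ card T * exp (- L)"
      using T(3) mult_left_mono[of "real (card T)" "real (card I)" "l\<^sup>2"] by (simp add: c_def)
    finally have e: "exp (- c) * (2 * exp (l\<^sup>2)) ^ card T \<le> 2 ^ card T * exp (- L)" .
    have "l * (\<Sum>i\<in>T. influence A T i) * b (I - T)
        \<le> (exp (- c) * (2 * exp (l\<^sup>2)) ^ card T + (c - 1) * a T) * b (I - T)"
      using sum_influence_le[OF T(1) assms(2,3), of A c] A b(1)
      by (intro mult_right_mono) (auto simp: a_def)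
    also have "\<dots> \<le> (2 ^ card T * exp (- L) + (c - 1) * a T) * b (I - T)"
      using e b(1) by (intro mult_right_mono) auto
    also have "\<dots> = 2 ^ card T * exp (- L) * b (I - T) + (c - 1) * (a T * b (I - T))"
      by (simp add: algebra_simps)
    also have "2 ^ card T * exp (- L) * b (I - T) \<le> 2 ^ card T * exp (- L) * 2 ^ card (I - T)"
      using b(2) by (intro mult_left_mono) auto
    also have "\<dots> = 2 ^ card I * exp (- L)"
      using T assms(1) by (simp add: card_Diff_subset flip: power_add)
    finally show ?thesis by simp
  qed
  then have "(\<Sum>T\<in>Pow I. l * (\<Sum>i\<in>T. influence A T i) * b (I - T))
      \<le> (\<Sum>T\<in>Pow I. 2 ^ card I * exp (- L) + (c - 1) * (a T * b (I - T)))"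
    by (rule sum_mono)
  also have "\<dots> = (2 * 2) ^ card I * exp (- L) + (c - 1) * (\<Sum>T\<in>Pow I. a T * b (I - T))"
    using assms(1) unfolding power_mult_distrib by (simp add: sum.distrib sum_distrib_left card_Pow)
  also have "(2 * 2 :: real) = 4"
    by simp
  finally show ?thesis
    by (simp only: a_def b_def c_def sum_distrib_left[symmetric] mult.assoc)
qed

text \<open>Complementing \<open>T\<close> exchanges the roles of \<open>A\<close> and
  \<open>B\<close>, so both influence sums obey the same bound and 10 = 5 * 2. The
  \<open>max 0\<close> serves the leaves with a different output, where the corruption is 0.\<close>

lemma corruption_rectangle_bound:
  fixes A B :: "'a set \<Rightarrow> real"
  assumes "finite I" "0 \<le> l" "l \<le> 1"
    and A: "\<And>u. 0 \<le> A u" "\<And>u. A u \<le> 1" and B: "\<And>v. 0 \<le> B v" "\<And>v. B v \<le> 1"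
  shows "max 0 (l * corruption I (\<lambda>u v. A u * B v))
    \<le> 10 * (4 ^ card I * exp (- L)
        + (l\<^sup>2 * card I + L - 1) * disjoint_sum I (\<lambda>u v. A u * B v))"
proof -
  let ?D = "disjoint_sum I (\<lambda>u v. A u * B v)"
  let ?E = "4 ^ card I * exp (- L) + (l\<^sup>2 * card I + L - 1) * ?D"
  define X where "X = (\<Sum>T\<in>Pow I. (\<Sum>i\<in>T. influence A T i) * (\<Sum>v\<in>Pow (I - T). B v))"
  define Y where "Y = (\<Sum>T\<in>Pow I. (\<Sum>i\<in>T. influence B T i) * (\<Sum>u\<in>Pow (I - T). A u))"
  have D: "?D = (\<Sum>T\<in>Pow I. (\<Sum>u\<in>Pow T. B u) * (\<Sum>v\<in>Pow (I - T). A v))"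
    unfolding disjoint_sum_product
    by (subst sum_Pow_complement[symmetric]) (auto intro!: sum.cong simp: double_diff mult.commute)
  have XY: "0 \<le> X" "0 \<le> Y"
    by (auto simp: X_def Y_def A B influence_nonneg intro!: sum_nonneg mult_nonneg_nonneg)
  have "l * X \<le> ?E"
    using influence_rectangle_le[OF assms(1-3), of A B L] A B by (simp add: X_def disjoint_sum_product)
  moreover have "l * Y \<le> ?E"
    using influence_rectangle_le[OF assms(1-3), of B A L] A B by (simp add: Y_def D)
  moreover have "corruption I (\<lambda>u v. A u * B v) \<le> 5 * (X + Y)"
    using corruption_rectangle_le[OF assms(1), of A B] A B
    by (simp add: X_def Y_def sum.distrib mult.commute)
  then have "l * corruption I (\<lambda>u v. A u * B v) \<le> 5 * (l * X + l * Y)"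
    using mult_left_mono[OF _ assms(2)] by (fastforce simp: algebra_simps)
  moreover have "0 \<le> l * X" "0 \<le> l * Y"
    using XY assms(2) by auto
  ultimately show ?thesis
    by (auto simp: max_def)
qed

section \<open>Protocols on disjoint and uniquely intersecting sets\<close>

lemma two_power_add_le: "(2 :: real) ^ m + 2 ^ n \<le> 2 * 2 ^ max m n"
  using power_increasing[of m "max m n" "2 :: real"] power_increasing[of n "max m n" "2 :: real"]
  by linarith

text \<open>Induction on the tree, where \<open>A\<close> and \<open>B\<close> describe the
  rectangle of inputs that reach the current node. Corruption and the mass
  \<open>disjoint_sum\<close> are additive when a message splits the rectangle, and
  \<open>2 ^ cost P\<close> bounds the number of leaves.\<close>

lemma corruption_protocol_rectangle:
  fixes \<xi> :: "'a set \<Rightarrow> 'x" and \<eta> :: "'a set \<Rightarrow> 'y" and P :: "('x, 'y, 'q) protocol"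
  assumes "finite I" "0 \<le> l" "l \<le> 1"
  shows "l * corruption I (\<lambda>u v. of_bool (A u) * of_bool (B v) * of_bool (run P (\<xi> u) (\<eta> v) = q))
    \<le> 10 * (4 ^ card I * exp (- L) * 2 ^ cost P
        + (l\<^sup>2 * card I + L - 1) * disjoint_sum I (\<lambda>u v. of_bool (A u) * of_bool (B v)))"
proof (induction P arbitrary: A B)
  case (Output p)
  have "l * corruption I (\<lambda>u v. of_bool (A u) * of_bool (B v) * of_bool (run (Output p) (\<xi> u) (\<eta> v) = q))
      \<le> max 0 (l * corruption I (\<lambda>u v. of_bool (A u) * of_bool (B v)))"
    by (cases "p = q") (auto simp: corruption_def disjoint_sum_def intersecting_sum_def)
  also have "\<dots> \<le> 10 * (4 ^ card I * exp (- L)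
        + (l\<^sup>2 * card I + L - 1) * disjoint_sum I (\<lambda>u v. of_bool (A u) * of_bool (B v)))"
    using assms by (intro corruption_rectangle_bound) auto
  finally show ?case
    by simp
next
  case (Alice h P P')
  define c where "c = l\<^sup>2 * card I + L - 1"
  let ?A = "\<lambda>u. A u \<and> h (\<xi> u)" and ?A' = "\<lambda>u. A u \<and> \<not> h (\<xi> u)"
  let ?G = "\<lambda>P A u v. of_bool (A u) * of_bool (B v) * of_bool (run P (\<xi> u) (\<eta> v) = q) :: real"
  let ?D = "\<lambda>A. disjoint_sum I (\<lambda>u v. of_bool (A u) * of_bool (B v))"
  have "?G (Alice h P P') A = (\<lambda>u v. ?G P ?A u v + ?G P' ?A' u v)"
    by (auto simp: fun_eq_iff)
  then have "l * corruption I (?G (Alice h P P') A)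
      = l * corruption I (?G P ?A) + l * corruption I (?G P' ?A')"
    by (simp only: corruption_add distrib_left)
  also have "\<dots> \<le> 10 * (4 ^ card I * exp (- L) * 2 ^ cost P + c * ?D ?A)
      + 10 * (4 ^ card I * exp (- L) * 2 ^ cost P' + c * ?D ?A')"
    using Alice.IH(1)[of ?A B] Alice.IH(2)[of ?A' B] unfolding c_def by (rule add_mono)
  also have "\<dots> = 10 * (4 ^ card I * exp (- L) * (2 ^ cost P + 2 ^ cost P') + c * (?D ?A + ?D ?A'))"
    by (simp add: algebra_simps)
  also have "?D ?A + ?D ?A' = ?D A"
  proof -
    have "(\<lambda>u v. of_bool (A u) * of_bool (B v) :: real)
        = (\<lambda>u v. of_bool (?A u) * of_bool (B v) + of_bool (?A' u) * of_bool (B v))"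
      by (auto simp: fun_eq_iff)
    then show ?thesis by (simp only: disjoint_sum_add)
  qed
  also have "(2 :: real) ^ cost P + 2 ^ cost P' \<le> 2 ^ cost (Alice h P P')"
    using two_power_add_le[of "cost P" "cost P'"] by simp
  finally show ?case
    by (simp add: c_def mult_left_mono)
next
  case (Bob h P P')
  define c where "c = l\<^sup>2 * card I + L - 1"
  let ?B = "\<lambda>v. B v \<and> h (\<eta> v)" and ?B' = "\<lambda>v. B v \<and> \<not> h (\<eta> v)"
  let ?G = "\<lambda>P B u v. of_bool (A u) * of_bool (B v) * of_bool (run P (\<xi> u) (\<eta> v) = q) :: real"
  let ?D = "\<lambda>B. disjoint_sum I (\<lambda>u v. of_bool (A u) * of_bool (B v))"
  have "?G (Bob h P P') B = (\<lambda>u v. ?G P ?B u v + ?G P' ?B' u v)"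
    by (auto simp: fun_eq_iff)
  then have "l * corruption I (?G (Bob h P P') B)
      = l * corruption I (?G P ?B) + l * corruption I (?G P' ?B')"
    by (simp only: corruption_add distrib_left)
  also have "\<dots> \<le> 10 * (4 ^ card I * exp (- L) * 2 ^ cost P + c * ?D ?B)
      + 10 * (4 ^ card I * exp (- L) * 2 ^ cost P' + c * ?D ?B')"
    using Bob.IH(1)[of A ?B] Bob.IH(2)[of A ?B'] unfolding c_def by (rule add_mono)
  also have "\<dots> = 10 * (4 ^ card I * exp (- L) * (2 ^ cost P + 2 ^ cost P') + c * (?D ?B + ?D ?B'))"
    by (simp add: algebra_simps)
  also have "?D ?B + ?D ?B' = ?D B"
  proof -
    have "(\<lambda>u v. of_bool (A u) * of_bool (B v) :: real)
        = (\<lambda>u v. of_bool (A u) * of_bool (?B v) + of_bool (A u) * of_bool (?B' v))"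
      by (auto simp: fun_eq_iff)
    then show ?thesis by (simp only: disjoint_sum_add)
  qed
  also have "(2 :: real) ^ cost P + 2 ^ cost P' \<le> 2 ^ cost (Bob h P P')"
    using two_power_add_le[of "cost P" "cost P'"] by simp
  finally show ?case
    by (simp add: c_def mult_left_mono)
qed

lemma corruption_protocol:
  fixes \<xi> :: "'a set \<Rightarrow> 'x" and \<eta> :: "'a set \<Rightarrow> 'y" and P :: "('x, 'y, 'q) protocol"
  assumes "finite I" "0 \<le> l" "l \<le> 1" "cost P \<le> k"
  shows "l * corruption I (\<lambda>u v. of_bool (run P (\<xi> u) (\<eta> v) = q))
    \<le> 10 * 4 ^ card I * (l\<^sup>2 * card I + k)"
proof -
  \<comment> \<open>With this \<open>L\<close> the exponential terms of at most \<open>2 ^ k\<close>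
    leaves add up to at most \<open>4 ^ card I\<close>, which the \<open>- 1\<close> in the
    rectangle bound cancels.\<close>
  define L where "L = k * ln (2 :: real)"
  have "exp (- L) * 2 ^ cost P \<le> exp (- L) * 2 ^ k"
    using assms(4) by (intro mult_left_mono power_increasing) auto
  also have "\<dots> = 1"
    by (simp add: L_def exp_minus exp_of_nat_mult)
  finally have e: "exp (- L) * 2 ^ cost P \<le> 1" .
  have "l * corruption I (\<lambda>u v. of_bool (run P (\<xi> u) (\<eta> v) = q))
      \<le> 10 * (4 ^ card I * exp (- L) * 2 ^ cost P + (l\<^sup>2 * card I + L - 1) * 4 ^ card I)"
    using corruption_protocol_rectangle[OF assms(1-3), of "\<lambda>_. True" "\<lambda>_. True" P \<xi> \<eta> q L]
      disjoint_sum_const[OF assms(1), of 1] by simp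
  also have "\<dots> = 10 * 4 ^ card I * (exp (- L) * 2 ^ cost P + (l\<^sup>2 * card I + L - 1))"
    by (simp add: algebra_simps)
  also have "\<dots> \<le> 10 * 4 ^ card I * (l\<^sup>2 * card I + k)"
  proof (intro mult_left_mono)
    have "L \<le> real k * 1"
      unfolding L_def using ln_le_minus_one[of "2 :: real"] by (intro mult_left_mono) auto
    then show "exp (- L) * 2 ^ cost P + (l\<^sup>2 * card I + L - 1) \<le> l\<^sup>2 * card I + k"
      using e by simp
  qed simp
  finally show ?thesis .
qed

lemma corruption_ge:
  fixes r s :: real
  assumes "finite I"
    and "\<And>u v. u \<inter> v = {} \<Longrightarrow> r \<le> G u v"
    and "\<And>u v i. i \<in> I \<Longrightarrow> u \<inter> v = {i} \<Longrightarrow> G u v \<le> s"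
  shows "(r - s) * card I * 4 ^ card I \<le> corruption I G"
proof -
  have "(r - s) * 4 ^ card I \<le> disjoint_sum I G - 4 * intersecting_sum I i G" if "i \<in> I" for i
  proof -
    have "disjoint_sum I (\<lambda>u v. r) \<le> disjoint_sum I G"
      unfolding disjoint_sum_def by (intro sum_mono assms(2)) auto
    moreover have "intersecting_sum I i G \<le> intersecting_sum I i (\<lambda>u v. s)"
      unfolding intersecting_sum_def by (intro sum_mono assms(3)[OF that]) auto
    ultimately show ?thesis
      using disjoint_sum_const[OF assms(1), of r] intersecting_sum_const[OF assms(1) that, of s]
      by (simp add: left_diff_distrib)
  qed
  then have "(\<Sum>i\<in>I. (r - s) * 4 ^ card I) \<le> corruption I G"
    unfolding corruption_def by (rule sum_mono)
  then show ?thesis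
    by (simp add: mult_ac)
qed

text \<open>Corruption is a linear combination of finitely many values of \<open>G\<close> and so
  commutes with the expectation: a bound for every outcome of the coins passes to the
  probabilities.\<close>

lemma corruption_expectation:
  fixes E :: "'a set \<Rightarrow> 'a set \<Rightarrow> 'p \<Rightarrow> bool"
  assumes "\<And>p. p \<in> set_pmf M \<Longrightarrow> corruption I (\<lambda>u v. of_bool (E u v p)) \<le> C"
  shows "corruption I (\<lambda>u v. measure_pmf.prob M {p. E u v p}) \<le> C"
proof -
  have int: "integrable (measure_pmf M) (\<lambda>p. of_bool (E u v p) :: real)" for u v
    by (rule measure_pmf.integrable_const_bound[where B = 1]) auto
  have prob: "measure_pmf.prob M {p. E u v p} = measure_pmf.expectation M (\<lambda>p. of_bool (E u v p))" for u v
  proof -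
    have "(\<lambda>p. of_bool (E u v p) :: real) = indicator {p. E u v p}"
      by (auto simp: fun_eq_iff indicator_def)
    then show ?thesis by simp
  qed
  have "corruption I (\<lambda>u v. measure_pmf.prob M {p. E u v p})
      = measure_pmf.expectation M (\<lambda>p. corruption I (\<lambda>u v. of_bool (E u v p)))"
    unfolding prob corruption_def disjoint_sum_def intersecting_sum_def
    by (simp add: Bochner_Integration.integral_sum Bochner_Integration.integral_diff int
        Bochner_Integration.integrable_sum)
  also have "\<dots> \<le> measure_pmf.expectation M (\<lambda>p. C)"
  proof (rule integral_mono_AE)
    show "integrable (measure_pmf M) (\<lambda>p. corruption I (\<lambda>u v. of_bool (E u v p)))"
      unfolding corruption_def disjoint_sum_def intersecting_sum_def
      by (intro Bochner_Integration.integrable_sum Bochner_Integration.integrable_diff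
          integrable_mult_right int)
  qed (auto simp: AE_measure_pmf_iff assms)
  finally show ?thesis
    by simp
qed

text \<open>Taking \<open>l = 1 / 80\<close> lets the first summand of the bound in \<open>corruption_protocol\<close> absorb
  half of the gap \<open>1 / 4\<close>.\<close>

lemma protocol_cost_ge:
  fixes M :: "'p pmf" and P :: "'p \<Rightarrow> ('x, 'y, 'q) protocol"
    and \<xi> :: "'p \<Rightarrow> 'a set \<Rightarrow> 'x" and \<eta> :: "'p \<Rightarrow> 'a set \<Rightarrow> 'y"
  assumes "finite I" "\<And>p. p \<in> set_pmf M \<Longrightarrow> cost (P p) \<le> k"
    and "\<And>u v. u \<inter> v = {} \<Longrightarrow> 3 / 4 \<le> measure_pmf.prob M {p. run (P p) (\<xi> p u) (\<eta> p v) = q}"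
    and "\<And>u v i. i \<in> I \<Longrightarrow> u \<inter> v = {i} \<Longrightarrow> measure_pmf.prob M {p. run (P p) (\<xi> p u) (\<eta> p v) = q} \<le> 1 / 2"
  shows "1 / 6400 * real (card I) \<le> k"
proof -
  let ?G = "\<lambda>u v. measure_pmf.prob M {p. run (P p) (\<xi> p u) (\<eta> p v) = q}"
  have "(3 / 4 - 1 / 2) * card I * 4 ^ card I \<le> corruption I ?G"
    using assms(1,3,4) by (rule corruption_ge)
  also have "\<dots> \<le> 800 * 4 ^ card I * ((1 / 80)\<^sup>2 * card I + k)"
  proof (rule corruption_expectation)
    fix p assume "p \<in> set_pmf M"
    then show "corruption I (\<lambda>u v. of_bool (run (P p) (\<xi> p u) (\<eta> p v) = q))
        \<le> 800 * 4 ^ card I * ((1 / 80)\<^sup>2 * card I + k)"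
      using corruption_protocol[OF assms(1) _ _ assms(2), of "1 / 80" p "\<xi> p" "\<eta> p" q] by simp
  qed
  finally have "4 ^ card I * (1 / 4 * card I) \<le> 4 ^ card I * (800 * ((1 / 80)\<^sup>2 * card I + real k))"
    by (simp add: mult_ac)
  then have "1 / 4 * card I \<le> 800 * ((1 / 80)\<^sup>2 * card I + real k)"
    by (subst (asm) mult_le_cancel_left_pos) simp_all
  then show ?thesis
    by (simp add: power2_eq_square)
qed

section \<open>Attaining the extrema\<close>

text \<open>With variable lists these elimination rules make \<open>blast\<close> and \<open>auto\<close> diverge.\<close>

declare nlists_Cons_Suc [rule del] nlists_appendE [rule del]

lemma finite_nlists: "finite A \<Longrightarrow> finite (nlists n A)"
  using finite_lists_length_eq[of A n] unfolding nlists_def by (simp only: conj_commute)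

lemma nlists_UNIV_nonempty: "nlists n UNIV \<noteq> {}"
  by (metis empty_iff in_nlists_UNIV length_replicate)

section \<open>Existence of protocols and attainment of the communication complexity\<close>

lemma ex_protocol_Alice:
  fixes h :: "'x \<Rightarrow> ('x, 'y, 'q) protocol"
  assumes "finite A"
  shows "\<exists>P. \<forall>x\<in>A. \<forall>y. run P x y = run (h x) x y"
  using assms
proof induction
  case (insert a A)
  then obtain P where "\<forall>x\<in>A. \<forall>y. run P x y = run (h x) x y" by blast
  then show ?case
    by (intro exI[of _ "Alice (\<lambda>x. x = a) (h a) P"]) simp
qed simp

lemma ex_protocol_Bob:
  fixes h :: "'y \<Rightarrow> ('x, 'y, 'q) protocol"
  assumes "finite B"
  shows "\<exists>P. \<forall>y\<in>B. \<forall>x. run P x y = run (h y) x y"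
  using assms
proof induction
  case (insert b B)
  then obtain P where "\<forall>y\<in>B. \<forall>x. run P x y = run (h y) x y" by blast
  then show ?case
    by (intro exI[of _ "Bob (\<lambda>y. y = b) (h b) P"]) simp
qed simp

text \<open>Alice identifies \<open>x\<close> and Bob then identifies \<open>y\<close>, testing one
  element at a time. Only existence matters here, not the cost.\<close>

lemma ex_protocol:
  fixes h :: "'x \<Rightarrow> 'y \<Rightarrow> 'q"
  assumes "finite A" "finite B"
  shows "\<exists>P. \<forall>x\<in>A. \<forall>y\<in>B. run P x y = h x y"
proof -
  have "\<exists>P :: ('x, 'y, 'q) protocol. \<forall>y\<in>B. \<forall>x'. run P x' y = h x y" for x
    using ex_protocol_Bob[OF assms(2), of "\<lambda>y. Output (h x y)"] by simp
  then obtain H :: "'x \<Rightarrow> ('x, 'y, 'q) protocol" where "\<forall>x. \<forall>y\<in>B. \<forall>x'. run (H x) x' y = h x y"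
    by metis
  moreover obtain P where "\<forall>x\<in>A. \<forall>y. run P x y = run (H x) x y"
    using ex_protocol_Alice[OF assms(1), of H] by blast
  ultimately show ?thesis
    by (intro exI[of _ P]) simp
qed

text \<open>The deterministic protocol from \<open>ex_protocol\<close> makes the set of admissible
  costs nonempty, and a nonempty set of naturals contains its infimum.\<close>

lemma randomised_cc_attained:
  fixes T :: "(('x \<times> 'y) \<times> 'q) set"
  assumes "finite A" "finite B" "\<And>x y. x \<in> A \<Longrightarrow> y \<in> B \<Longrightarrow> \<exists>q. ((x, y), q) \<in> T"
  shows "\<exists>R. (\<forall>P\<in>set_pmf R. cost P \<le> randomised_cc A B T) \<and> solves_with_bounded_error R A B T"
proof -
  obtain P where P: "\<forall>x\<in>A. \<forall>y\<in>B. run P x y = (SOME q. ((x, y), q) \<in> T)"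
    using ex_protocol[OF assms(1,2), of "\<lambda>x y. SOME q. ((x, y), q) \<in> T"] by blast
  have "solves_with_bounded_error (return_pmf P) A B T"
    using P someI_ex[OF assms(3)] by (auto simp: solves_with_bounded_error_def)
  then have "{d. \<exists>R. (\<forall>P\<in>set_pmf R. cost P \<le> d) \<and> solves_with_bounded_error R A B T} \<noteq> {}"
    by (auto intro!: exI[of _ "cost P"] exI[of _ "return_pmf P"])
  from Inf_nat_def1[OF this] show ?thesis
    by (simp add: randomised_cc_def)
qed

lemma randomised_cc_le:
  assumes "\<And>P. P \<in> set_pmf R \<Longrightarrow> cost P \<le> d" "solves_with_bounded_error R A B T"
  shows "randomised_cc A B T \<le> d"
  unfolding randomised_cc_def using assms by (intro cInf_lower) auto

lemma composed_cc_attained: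
  assumes "finite X" "finite Y" "search_problem n Q S"
  shows "\<exists>R. (\<forall>P\<in>set_pmf R. cost P \<le> composed_cc n X Y g S)
    \<and> solves_with_bounded_error R (nlists n X) (nlists n Y) (composed n X Y g S)"
  unfolding composed_cc_def
proof (intro randomised_cc_attained finite_nlists assms)
  fix x y assume "x \<in> nlists n X" "y \<in> nlists n Y"
  moreover from this have "map2 g x y \<in> cube n"
    by (simp add: in_nlists_UNIV)
  ultimately show "\<exists>q. ((x, y), q) \<in> composed n X Y g S"
    using assms(3) by (auto simp: composed_def search_problem_def)
qed

section \<open>Sensitive blocks and critical inputs\<close>

lemma flip_empty [simp]: "flip \<alpha> {} = \<alpha>"
  by (simp add: flip_def map_nth)

lemma flip_in_cube: "\<alpha> \<in> cube n \<Longrightarrow> flip \<alpha> B \<in> cube n"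
  by (simp add: flip_def in_nlists_UNIV)

text \<open>Sensitive blocks are nonempty, so choosing a point in each injects them into
  \<open>{..<n}\<close>. The maximum is therefore over a finite set, which contains 0, and is
  attained.\<close>

lemma block_sensitivity_witness:
  fixes f :: "bool list \<Rightarrow> 'q"
  obtains B :: "nat \<Rightarrow> nat set" where
    "\<forall>i<block_sensitivity n f \<alpha>. f (flip \<alpha> (B i)) \<noteq> f \<alpha>"
    "disjoint_family_on B {..<block_sensitivity n f \<alpha>}"
proof -
  define blocks where "blocks b B \<longleftrightarrow> (\<forall>i<b. B i \<subseteq> {..<n} \<and> f (flip \<alpha> (B i)) \<noteq> f \<alpha>) \<and>
    disjoint_family_on B {..<b}" for b and B :: "nat \<Rightarrow> nat set"
  have "b \<le> n" if "blocks b B" for b B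
  proof -
    have ne: "\<exists>j. j \<in> B i" if "i < b" for i
    proof (rule ccontr)
      assume "\<nexists>j. j \<in> B i"
      then have "B i = {}" by blast
      with \<open>i < b\<close> \<open>blocks b B\<close> show False
        by (auto simp: blocks_def)
    qed
    define h where "h i = (SOME j. j \<in> B i)" for i
    have h: "h i \<in> B i" if "i < b" for i
      unfolding h_def using ne[OF that] by (rule someI_ex)
    have "i = j" if "i < b" "j < b" "h i = h j" for i j
    proof (rule ccontr)
      assume "i \<noteq> j"
      then have "B i \<inter> B j = {}"
        using \<open>blocks b B\<close> that(1,2) by (simp add: blocks_def disjoint_family_on_def)
      then show False
        using h[of i] h[of j] that by auto
    qed
    then have "inj_on h {..<b}"
      by (auto simp: inj_on_def)
    moreover have "h ` {..<b} \<subseteq> {..<n}"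
      using h \<open>blocks b B\<close> unfolding blocks_def by blast
    ultimately show ?thesis
      using card_inj_on_le[of h "{..<b}" "{..<n}"] by simp
  qed
  then have "finite {b. \<exists>B. blocks b B}"
    using finite_subset[of "{b. \<exists>B. blocks b B}" "{..n}"] by blast
  moreover have "blocks 0 (\<lambda>_. {})"
    by (simp add: blocks_def disjoint_family_on_def)
  then have "{b. \<exists>B. blocks b B} \<noteq> {}"
    by blast
  ultimately have "Max {b. \<exists>B. blocks b B} \<in> {b. \<exists>B. blocks b B}"
    by (rule Max_in)
  then obtain B where "blocks (block_sensitivity n f \<alpha>) B"
    by (auto simp: block_sensitivity_def blocks_def)
  then show ?thesis
    using that[of B] by (simp add: blocks_def)
qed

lemma finite_critical_inputs: "finite (critical_inputs n S)"
  by (rule finite_subset[OF _ finite_nlists[of UNIV n]]) (auto simp: critical_inputs_def)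

lemma critical_block_sensitivity_le:
  assumes "f \<in> solving_functions n S"
    and "\<And>\<alpha>. \<alpha> \<in> critical_inputs n S \<Longrightarrow> block_sensitivity n f \<alpha> \<le> b"
  shows "critical_block_sensitivity n S \<le> b"
proof -
  have "critical_block_sensitivity n S \<le> (SUP \<alpha>\<in>critical_inputs n S. block_sensitivity n f \<alpha>)"
    unfolding critical_block_sensitivity_def using assms(1) by (intro cINF_lower) auto
  \<comment> \<open>Without critical inputs the supremum is 0 by convention on the naturals.\<close>
  also have "\<dots> \<le> b"
    using assms(2) finite_critical_inputs[of n S]
    by (cases "critical_inputs n S = {}") (auto simp: cSUP_least Sup_nat_def)
  finally show ?thesis .
qed

section \<open>The gadget\<close>

definition gadget :: "nat \<Rightarrow> nat \<Rightarrow> bool" where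
  "gadget x y \<longleftrightarrow> 2 \<le> (x + y) mod 4"

text \<open>
  A coin \<open>(p, q, \<sigma>)\<close> gives Alice the random residue \<open>a = p + 2 q\<close>. Setting \<open>u\<close> or \<open>v\<close> moves \<open>x + y\<close> by
  \<open>1\<close> or \<open>- 1\<close> modulo \<open>4\<close>, depending on \<open>\<sigma>\<close>, starting from \<open>2 c\<close> or \<open>2 c + 1\<close>: the gadget value is
  negated exactly when both are set. Bob uses \<open>3 a\<close> for \<open>- a\<close>. The permutation \<open>recoin u v\<close> of the
  coins turns the encoding by \<open>u\<close>, \<open>v\<close> of \<open>c\<close> into a plain encoding of \<open>c \<noteq> (u \<and> v)\<close>.
\<close>

type_synonym coin = "bool \<times> bool \<times> bool"

fun alice :: "coin \<Rightarrow> bool \<Rightarrow> nat" where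
  "alice (p, q, \<sigma>) u = (of_bool p + 2 * of_bool q + (if \<sigma> then 1 else 3) * of_bool u) mod 4"

fun bob :: "bool \<Rightarrow> coin \<Rightarrow> bool \<Rightarrow> nat" where
  "bob c (p, q, \<sigma>) v =
     (3 * (of_bool p + 2 * of_bool q) + of_bool (\<not> \<sigma>) + (if \<sigma> then 1 else 3) * of_bool v + 2 * of_bool c) mod 4"

fun recoin :: "bool \<Rightarrow> bool \<Rightarrow> coin \<Rightarrow> coin" where
  "recoin u v (p, q, \<sigma>) =
     (odd (alice (p, q, \<sigma>) u), 2 \<le> alice (p, q, \<sigma>) u, \<sigma> \<noteq> (u \<noteq> v))"

lemma gadget_encoding: "gadget (alice r False) (bob c r False) = c"
proof (cases r)
  case (fields p q \<sigma>)
  then show ?thesis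
    by (cases p; cases q; cases \<sigma>; cases c; simp add: gadget_def)
qed

lemma alice_recoin: "alice (recoin u v r) False = alice r u"
proof (cases r)
  case (fields p q \<sigma>)
  then show ?thesis
    by (cases p; cases q; cases \<sigma>; cases u; simp)
qed

text \<open>The coin \<sigma> fixes the parity of the residue of \<open>x + y\<close>. If just one
  of \<open>u\<close>, \<open>v\<close> is set, the residue moves to the other one with the same
  gadget value, so \<sigma> toggles; if both are set, it moves by 2, so \<sigma> stays and
  \<open>c\<close> is negated.\<close>

lemma bob_recoin: "bob (c \<noteq> (u \<and> v)) (recoin u v r) False = bob c r v"
proof (cases r)
  case (fields p q \<sigma>)
  then show ?thesis
    by (cases p; cases q; cases \<sigma>; cases u; cases v; cases c; simp)
qed

lemma alice_less: "alice r u < 4"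
  by (cases r) simp

lemma bob_less: "bob c r v < 4"
  by (cases r) simp

text \<open>The third component reveals \<sigma>; the first two are the binary digits of Alice's
  residue, from which the shift caused by \<open>u\<close> can then be subtracted.\<close>

lemma inj_recoin: "inj (recoin u v)"
proof (rule injI)
  fix r s assume "recoin u v r = recoin u v s"
  moreover obtain p q \<sigma> p' q' \<sigma>' where "r = (p, q, \<sigma>)" "s = (p', q', \<sigma>')"
    by (metis prod_cases3)
  ultimately show "r = s"
    by (cases p; cases q; cases \<sigma>; cases p'; cases q'; cases \<sigma>'; cases u; simp)
qed

section \<open>Encodings of whole inputs, coordinate by coordinate\<close>

definition alices :: "nat \<Rightarrow> coin list \<Rightarrow> (nat \<Rightarrow> bool) \<Rightarrow> nat list" where
  "alices n rs u = map (\<lambda>j. alice (rs ! j) (u j)) [0..<n]"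

definition bobs :: "nat \<Rightarrow> bool list \<Rightarrow> coin list \<Rightarrow> (nat \<Rightarrow> bool) \<Rightarrow> nat list" where
  "bobs n \<alpha> rs v = map (\<lambda>j. bob (\<alpha> ! j) (rs ! j) (v j)) [0..<n]"

definition recoins :: "nat \<Rightarrow> (nat \<Rightarrow> bool) \<Rightarrow> (nat \<Rightarrow> bool) \<Rightarrow> coin list \<Rightarrow> coin list" where
  "recoins n u v rs = map (\<lambda>j. recoin (u j) (v j) (rs ! j)) [0..<n]"

lemma gadget_encodings:
  "\<alpha> \<in> cube n \<Longrightarrow> map2 gadget (alices n rs (\<lambda>_. False)) (bobs n \<alpha> rs (\<lambda>_. False)) = \<alpha>"
  by (intro nth_equalityI) (auto simp: alices_def bobs_def in_nlists_UNIV gadget_encoding simp del: alice.simps bob.simps)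

lemma alices_recoins: "alices n (recoins n u v rs) (\<lambda>_. False) = alices n rs u"
  by (simp add: alices_def recoins_def alice_recoin)

lemma bobs_recoins:
  "bobs n (map (\<lambda>j. \<alpha> ! j \<noteq> (u j \<and> v j)) [0..<n]) (recoins n u v rs) (\<lambda>_. False) = bobs n \<alpha> rs v"
  unfolding bobs_def
proof (rule map_cong[OF refl])
  fix j assume "j \<in> set [0..<n]"
  then show "bob (map (\<lambda>j. \<alpha> ! j \<noteq> (u j \<and> v j)) [0..<n] ! j) (recoins n u v rs ! j) False
      = bob (\<alpha> ! j) (rs ! j) (v j)"
    using bob_recoin[of "\<alpha> ! j" "u j" "v j" "rs ! j"] by (simp add: recoins_def)
qed

lemma alices_in: "alices n rs u \<in> nlists n {..<4}"
  by (rule nlistsI) (auto simp: alices_def alice_less)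

lemma bobs_in: "bobs n \<alpha> rs v \<in> nlists n {..<4}"
  by (rule nlistsI) (auto simp: bobs_def bob_less)

lemma bij_betw_recoins: "bij_betw (recoins n u v) (nlists n UNIV) (nlists n UNIV)"
proof -
  have "inj_on (recoins n u v) (nlists n UNIV)"
  proof (rule inj_onI)
    fix rs ss assume rs: "rs \<in> nlists n UNIV" and ss: "ss \<in> nlists n UNIV"
      and eq: "recoins n u v rs = recoins n u v ss"
    show "rs = ss"
    proof (rule nth_equalityI)
      fix j assume "j < length rs"
      then have j: "j < n" using rs by simp
      then have "recoin (u j) (v j) (rs ! j) = recoin (u j) (v j) (ss ! j)"
        using arg_cong[OF eq, of "\<lambda>xs. xs ! j"] by (simp add: recoins_def)
      then show "rs ! j = ss ! j"
        by (rule injD[OF inj_recoin])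
    qed (use rs ss in simp)
  qed
  moreover have "recoins n u v ` nlists n UNIV \<subseteq> nlists n UNIV"
    by (auto simp: recoins_def in_nlists_UNIV)
  ultimately show ?thesis
    unfolding bij_betw_def by (intro conjI endo_inj_surj[OF finite_nlists[OF finite]])
qed

section \<open>Output distribution of a protocol on random encodings\<close>

definition coin_protocol_pmf ::
    "nat \<Rightarrow> (nat list, nat list, 'q) protocol pmf
      \<Rightarrow> (coin list \<times> (nat list, nat list, 'q) protocol) pmf" where
  "coin_protocol_pmf n R = pair_pmf (pmf_of_set (nlists n UNIV)) R"

definition output_prob ::
    "nat \<Rightarrow> (nat list, nat list, 'q) protocol pmf \<Rightarrow> bool list \<Rightarrow> 'q set \<Rightarrow> real" where
  "output_prob n R z K = measure_pmf.prob (coin_protocol_pmf n R)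
     {(rs, P). run P (alices n rs (\<lambda>_. False)) (bobs n z rs (\<lambda>_. False)) \<in> K}"

text \<open>Random self-reduction: \<open>recoins n u v\<close> permutes the uniform coins, so the
  encoding of \<alpha> by \<open>u\<close> and \<open>v\<close> is distributed like a plain random
  encoding of \<alpha> with the bits where both \<open>u\<close> and \<open>v\<close> hold
  negated.\<close>

lemma prob_alices_bobs:
  "measure_pmf.prob (coin_protocol_pmf n R) {(rs, P). run P (alices n rs u) (bobs n \<alpha> rs v) = q}
    = output_prob n R (map (\<lambda>j. \<alpha> ! j \<noteq> (u j \<and> v j)) [0..<n]) {q}"
proof -
  define \<beta> where "\<beta> = map (\<lambda>j. \<alpha> ! j \<noteq> (u j \<and> v j)) [0..<n]"
  have \<beta>: "bobs n \<beta> (recoins n u v rs) (\<lambda>_. False) = bobs n \<alpha> rs v" for rs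
    unfolding \<beta>_def by (rule bobs_recoins)
  have "map_pmf (apfst (recoins n u v)) (coin_protocol_pmf n R) = coin_protocol_pmf n R"
    using map_pmf_of_set_bij_betw[OF bij_betw_recoins nlists_UNIV_nonempty finite_nlists[OF finite], of n u v]
    by (simp add: coin_protocol_pmf_def flip: pair_map_pmf1)
  then have "output_prob n R \<beta> {q}
      = measure_pmf.prob (map_pmf (apfst (recoins n u v)) (coin_protocol_pmf n R))
        {(rs, P). run P (alices n rs (\<lambda>_. False))
          (bobs n \<beta> rs (\<lambda>_. False)) \<in> {q}}"
    by (simp add: output_prob_def)
  also have "\<dots> = measure_pmf.prob (coin_protocol_pmf n R)
      {(rs, P). run P (alices n rs u) (bobs n \<alpha> rs v) = q}"
    unfolding measure_map_pmf
    by (rule arg_cong[where f = "measure_pmf.prob _"])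
       (auto simp: alices_recoins \<beta>)
  finally show ?thesis
    by (simp only: \<beta>_def)
qed

lemma output_prob_disjoint:
  assumes "K \<inter> K' = {}"
  shows "output_prob n R z K + output_prob n R z K' \<le> 1"
proof -
  let ?E = "\<lambda>K. {(rs, P). run P (alices n rs (\<lambda>_. False)) (bobs n z rs (\<lambda>_. False)) \<in> K}"
  have "?E K \<inter> ?E K' = {}"
    using assms by auto
  then have "output_prob n R z K + output_prob n R z K'
      = measure_pmf.prob (coin_protocol_pmf n R) (?E K \<union> ?E K')"
    by (simp add: output_prob_def measure_pmf.finite_measure_Union)
  then show ?thesis by simp
qed

text \<open>Every choice of coins \<open>rs\<close> yields a valid input of the composed problem
  that encodes \<open>z\<close>, so the success bound survives averaging over
  \<open>rs\<close>.\<close>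

lemma output_prob_feasible:
  assumes "solves_with_bounded_error R (nlists n {..<4}) (nlists n {..<4})
      (composed n {..<4} {..<4} gadget S)" "z \<in> cube n"
  shows "3 / 4 \<le> output_prob n R z {q. (z, q) \<in> S}"
proof -
  let ?U = "pmf_of_set (nlists n UNIV :: coin list set)"
  let ?x = "\<lambda>rs. alices n rs (\<lambda>_. False)" and ?y = "\<lambda>rs. bobs n z rs (\<lambda>_. False)"
  let ?E = "{(rs :: coin list, P). (z, run P (?x rs) (?y rs)) \<in> S}"
  have ge: "ennreal (3 / 4) \<le> emeasure (measure_pmf R) (Pair rs -` ?E)" for rs
  proof -
    have "3 / 4 \<le> measure_pmf.prob R
        {P. ((?x rs, ?y rs), run P (?x rs) (?y rs)) \<in> composed n {..<4} {..<4} gadget S}"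
      using assms(1) alices_in bobs_in unfolding solves_with_bounded_error_def by blast
    also have "\<dots> = measure_pmf.prob R (Pair rs -` ?E)"
      using alices_in bobs_in assms(2)
      by (intro arg_cong[where f = "measure_pmf.prob _"]) (auto simp: composed_def gadget_encodings)
    finally show ?thesis
      by (simp add: measure_pmf.emeasure_eq_measure)
  qed
  have "ennreal (3 / 4) = (\<integral>\<^sup>+rs. ennreal (3 / 4) \<partial>measure_pmf ?U)"
    by simp
  also have "\<dots> \<le> (\<integral>\<^sup>+rs. emeasure (measure_pmf R) (Pair rs -` ?E) \<partial>measure_pmf ?U)"
    using ge nlists_UNIV_nonempty finite_nlists[OF finite]
    by (intro nn_integral_mono_AE) (auto simp: AE_measure_pmf_iff)
  also have "\<dots> = emeasure (measure_pmf (coin_protocol_pmf n R)) ?E"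
    by (simp add: coin_protocol_pmf_def pair_pmf_def flip: map_pmf_def)
  also have "\<dots> = ennreal (output_prob n R z {q. (z, q) \<in> S})"
    by (simp add: output_prob_def measure_pmf.emeasure_eq_measure)
  finally show ?thesis
    by (simp add: output_prob_def)
qed

text \<open>
  At most one output has probability above \<open>1 / 2\<close>, and it is feasible because the infeasible outputs
  share probability at most \<open>1 / 4\<close>.
\<close>

definition likely_solution ::
    "nat \<Rightarrow> (nat list, nat list, 'q) protocol pmf \<Rightarrow> (bool list \<times> 'q) set \<Rightarrow> bool list \<Rightarrow> 'q" where
  "likely_solution n R S z =
     (SOME q. (z, q) \<in> S \<and> (\<forall>q'. 1 / 2 < output_prob n R z {q'} \<longrightarrow> q' = q))"

lemma likely_solution:
  assumes "search_problem n Q S" "z \<in> cube n"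
    and "solves_with_bounded_error R (nlists n {..<4}) (nlists n {..<4})
      (composed n {..<4} {..<4} gadget S)"
  shows "(z, likely_solution n R S z) \<in> S"
    and "q \<noteq> likely_solution n R S z \<Longrightarrow> output_prob n R z {q} \<le> 1 / 2"
proof -
  have "\<exists>q. (z, q) \<in> S \<and> (\<forall>q'. 1 / 2 < output_prob n R z {q'} \<longrightarrow> q' = q)"
  proof (cases "\<exists>q. 1 / 2 < output_prob n R z {q}")
    case True
    then obtain q where q: "1 / 2 < output_prob n R z {q}" by blast
    have "(z, q) \<in> S"
      using output_prob_disjoint[of "{q}" "{q. (z, q) \<in> S}" n R z] output_prob_feasible[OF assms(3,2)] q
      by force
    moreover have "q' = q" if "1 / 2 < output_prob n R z {q'}" for q'
      using output_prob_disjoint[of "{q}" "{q'}" n R z] q that by force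
    ultimately show ?thesis by blast
  next
    case False
    then show ?thesis
      using assms(1,2) by (auto simp: search_problem_def)
  qed
  from someI_ex[OF this] show "(z, likely_solution n R S z) \<in> S"
    and "q \<noteq> likely_solution n R S z \<Longrightarrow> output_prob n R z {q} \<le> 1 / 2"
    unfolding likely_solution_def by force+
qed

text \<open>Reduction from set disjointness on the indices of the sensitive blocks:
  \<open>w u\<close> marks the union of the blocks indexed by \<open>u\<close>. Disjointness of the
  blocks makes \<open>w u\<close> and \<open>w v\<close> meet exactly in the blocks indexed by
  \<open>u \<inter> v\<close>, so disjoint pairs encode \<alpha> and pairs that meet in
  \<open>i\<close> encode \<open>flip \<alpha> (B i)\<close>.\<close>

lemma block_sensitivity_le_cost:
  assumes S: "search_problem n Q S" and \<alpha>: "\<alpha> \<in> critical_inputs n S"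
    and R: "\<And>P. P \<in> set_pmf R \<Longrightarrow> cost P \<le> k"
      "solves_with_bounded_error R (nlists n {..<4}) (nlists n {..<4})
        (composed n {..<4} {..<4} gadget S)"
  shows "1 / 6400 * real (block_sensitivity n (likely_solution n R S) \<alpha>) \<le> k"
proof -
  define f where "f = likely_solution n R S"
  define b where "b = block_sensitivity n f \<alpha>"
  obtain B :: "nat \<Rightarrow> nat set" where B: "\<forall>i<b. f (flip \<alpha> (B i)) \<noteq> f \<alpha>"
    "disjoint_family_on B {..<b}"
    unfolding b_def by (rule block_sensitivity_witness)
  have cube: "\<alpha> \<in> cube n" and uniq: "\<exists>!q. (\<alpha>, q) \<in> S"
    using \<alpha> by (auto simp: critical_inputs_def)
  define w where "w u j \<longleftrightarrow> (\<exists>i\<in>u \<inter> {..<b}. j \<in> B i)" for u j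
  have same: "i = i'" if "i < b" "i' < b" "j \<in> B i" "j \<in> B i'" for i i' j
    using disjoint_family_onD[OF B(2), of i i'] that by blast
  have w: "w u j \<and> w v j \<longleftrightarrow> w (u \<inter> v) j" for u v j
  proof
    assume "w u j \<and> w v j"
    then obtain i i' where i: "i \<in> u" "i < b" "j \<in> B i" "i' \<in> v" "i' < b" "j \<in> B i'"
      unfolding w_def by blast
    then have "i = i'"
      by (intro same)
    then show "w (u \<inter> v) j"
      using i by (auto simp: w_def)
  qed (auto simp: w_def)
  let ?M = "coin_protocol_pmf n R"
  let ?G = "\<lambda>u v. measure_pmf.prob ?M
    {p. run (snd p) (alices n (fst p) (w u)) (bobs n \<alpha> (fst p) (w v)) = f \<alpha>}"
  have G: "?G u v = output_prob n R (flip \<alpha> {j. w (u \<inter> v) j}) {f \<alpha>}" for u v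
  proof -
    have "flip \<alpha> {j. w (u \<inter> v) j} = map (\<lambda>j. \<alpha> ! j \<noteq> (w u j \<and> w v j)) [0..<n]"
      using cube by (auto simp: flip_def w)
    then show ?thesis
      using prob_alices_bobs[of n R "w u" \<alpha> "w v" "f \<alpha>"] by (simp only: case_prod_beta')
  qed
  have "1 / 6400 * real (card {..<b}) \<le> k"
  proof (rule protocol_cost_ge[where M = ?M and P = snd and q = "f \<alpha>"])
    fix p assume "p \<in> set_pmf ?M"
    then show "cost (snd p) \<le> k"
      using R(1) by (auto simp: coin_protocol_pmf_def)
  next
    fix u v :: "nat set" assume "u \<inter> v = {}"
    then have "?G u v = output_prob n R \<alpha> {f \<alpha>}"
      by (simp add: G w_def)
    \<comment> \<open>Criticality enters here: the success probability at \<alpha> belongs to a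
      single output.\<close>
    moreover have "{q. (\<alpha>, q) \<in> S} = {f \<alpha>}"
      using uniq likely_solution(1)[OF S cube R(2)] by (auto simp: f_def)
    ultimately show "3 / 4 \<le> ?G u v"
      using output_prob_feasible[OF R(2) cube] by simp
  next
    fix u v :: "nat set" and i assume i: "i \<in> {..<b}" "u \<inter> v = {i}"
    then have "?G u v = output_prob n R (flip \<alpha> (B i)) {f \<alpha>}"
      by (simp add: G w_def)
    moreover have "f \<alpha> \<noteq> f (flip \<alpha> (B i))"
      using B(1) i(1) by (metis lessThan_iff)
    ultimately show "?G u v \<le> 1 / 2"
      using likely_solution(2)[OF S flip_in_cube[OF cube] R(2), of "f \<alpha>" "B i"]
      by (simp only: f_def not_False_eq_True simp_thms)
  qed simp
  then show ?thesis
    by (simp add: b_def f_def)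
qed

text \<open>The function \<open>likely_solution n R S\<close> depends only on the protocol, so one
  candidate in the minimum over solving functions bounds the block sensitivity at all critical
  inputs at once.\<close>

lemma gadget_critical_bs_lower_bound:
  "critical_bs_lower_bound TYPE('q) {..<4} {..<4} gadget (1 / 6400)"
  unfolding critical_bs_lower_bound_def
proof (intro allI impI)
  fix n and Q :: "'q set" and S
  assume S: "search_problem n Q S"
  let ?k = "composed_cc n {..<4} {..<4} gadget S"
  obtain R where R: "\<And>P. P \<in> set_pmf R \<Longrightarrow> cost P \<le> ?k"
    "solves_with_bounded_error R (nlists n {..<4}) (nlists n {..<4})
      (composed n {..<4} {..<4} gadget S)"
    using composed_cc_attained[OF finite_lessThan finite_lessThan S, of 4 4 gadget] by blast
  have "critical_block_sensitivity n S \<le> 6400 * ?k"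
  proof (rule critical_block_sensitivity_le)
    show "likely_solution n R S \<in> solving_functions n S"
      using likely_solution(1)[OF S _ R(2)] by (simp add: solving_functions_def)
  next
    fix \<alpha> assume "\<alpha> \<in> critical_inputs n S"
    from block_sensitivity_le_cost[OF S this R]
    show "block_sensitivity n (likely_solution n R S) \<alpha> \<le> 6400 * ?k"
      by simp
  qed
  then show "1 / 6400 * real (critical_block_sensitivity n S) \<le> real ?k"
    by simp
qed

section \<open>Independence of the type of solutions\<close>

lemma run_map_protocol: "run (map_protocol h P) x y = h (run P x y)"
  by (induction P) auto

lemma cost_map_protocol: "cost (map_protocol h P) = cost P"
  by (induction P) auto

text \<open>
  Solutions that are feasible for the same inputs are merged, which leaves finitely many. Merging may
  create critical inputs, but that only increases the critical block sensitivity.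
\<close>

lemma critical_bs_lower_bound_transfer:
  assumes "finite X" "finite Y" and nat: "critical_bs_lower_bound TYPE(nat) X Y g c" and "0 < c"
  shows "critical_bs_lower_bound TYPE('q) X Y g c"
  unfolding critical_bs_lower_bound_def
proof (intro allI impI)
  fix n and Q :: "'q set" and S
  assume S: "search_problem n Q S"
  have "finite (Pow (cube n))"
    by (simp add: finite_nlists)
  from finite_imp_inj_to_nat_seg[OF this]
  obtain \<iota> :: "bool list set \<Rightarrow> nat" where \<iota>: "inj_on \<iota> (Pow (cube n))"
    by blast
  define \<rho> where "\<rho> q = \<iota> {\<alpha>. (\<alpha>, q) \<in> S}" for q
  define S' where "S' = (\<lambda>(\<alpha>, q). (\<alpha>, \<rho> q)) ` S"
  have \<rho>: "(\<alpha>, q) \<in> S" if "(\<alpha>, q') \<in> S" "\<rho> q' = \<rho> q" for \<alpha> q q'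
  proof -
    have "{\<alpha>. (\<alpha>, q) \<in> S} \<in> Pow (cube n)" for q
      using S by (auto simp: search_problem_def)
    then have "{\<alpha>. (\<alpha>, q') \<in> S} = {\<alpha>. (\<alpha>, q) \<in> S}"
      using inj_onD[OF \<iota>] that(2) by (simp add: \<rho>_def)
    then show ?thesis using that(1) by blast
  qed
  have S'_iff: "(\<alpha>, \<rho> q) \<in> S' \<longleftrightarrow> (\<alpha>, q) \<in> S" for \<alpha> q
    using \<rho> by (force simp: S'_def)
  have S': "search_problem n UNIV S'"
    using S by (force simp: search_problem_def S'_def)
  have "critical_block_sensitivity n S \<le> critical_block_sensitivity n S'"
    unfolding critical_block_sensitivity_def[of n S']
  proof (rule cINF_greatest)
    show "solving_functions n S' \<noteq> {}"
    proof -
      have "\<forall>\<alpha>. \<exists>q. \<alpha> \<in> cube n \<longrightarrow> (\<alpha>, q) \<in> S'"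
        using S' by (auto simp: search_problem_def)
      then obtain f where "\<forall>\<alpha>. \<alpha> \<in> cube n \<longrightarrow> (\<alpha>, f \<alpha>) \<in> S'" by metis
      then show ?thesis by (auto simp: solving_functions_def)
    qed
    fix f assume f: "f \<in> solving_functions n S'"
    \<comment> \<open>One solution is chosen from each merged class. On the cube \<open>f\<close>
      takes values in the range of \<rho>, so \<open>f'\<close> distinguishes the same pairs of
      inputs as \<open>f\<close>.\<close>
    define f' where "f' \<alpha> = inv \<rho> (f \<alpha>)" for \<alpha>
    have f': "\<rho> (f' \<alpha>) = f \<alpha>" if "\<alpha> \<in> cube n" for \<alpha>
    proof -
      have "f \<alpha> \<in> range \<rho>"
        using f that by (force simp: solving_functions_def S'_def)
      then show ?thesis by (simp add: f'_def f_inv_into_f)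
    qed
    show "critical_block_sensitivity n S \<le> (SUP \<alpha>\<in>critical_inputs n S'. block_sensitivity n f \<alpha>)"
    proof (rule critical_block_sensitivity_le)
      have "(\<alpha>, f' \<alpha>) \<in> S" if "\<alpha> \<in> cube n" for \<alpha>
        using f f'[OF that] that by (simp add: solving_functions_def flip: S'_iff)
      then show "f' \<in> solving_functions n S"
        by (simp add: solving_functions_def)
    next
      fix \<alpha> assume \<alpha>: "\<alpha> \<in> critical_inputs n S"
      then have cube: "\<alpha> \<in> cube n" and "\<exists>!q. (\<alpha>, q) \<in> S"
        by (auto simp: critical_inputs_def)
      then have "\<exists>!q. (\<alpha>, q) \<in> S'"
        by (force simp: S'_def)
      then have "\<alpha> \<in> critical_inputs n S'"
        using cube by (simp add: critical_inputs_def)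
      moreover have "f' (flip \<alpha> B) \<noteq> f' \<alpha> \<longleftrightarrow> f (flip \<alpha> B) \<noteq> f \<alpha>" for B
        using f'[OF cube] f'[OF flip_in_cube[OF cube], of B] unfolding f'_def by metis
      then have "block_sensitivity n f' \<alpha> = block_sensitivity n f \<alpha>"
        by (simp add: block_sensitivity_def)
      ultimately show "block_sensitivity n f' \<alpha> \<le> (SUP \<alpha>\<in>critical_inputs n S'. block_sensitivity n f \<alpha>)"
        by (auto intro!: cSUP_upper bdd_above_finite finite_critical_inputs)
    qed
  qed
  moreover have "composed_cc n X Y g S' \<le> composed_cc n X Y g S"
  proof -
    obtain R where R: "\<And>P. P \<in> set_pmf R \<Longrightarrow> cost P \<le> composed_cc n X Y g S"
      "solves_with_bounded_error R (nlists n X) (nlists n Y) (composed n X Y g S)"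
      using composed_cc_attained[OF assms(1,2) S, of g] by blast
    show ?thesis
      unfolding composed_cc_def[of n X Y g S']
    \<comment> \<open>Relabelling the leaves by \<rho> preserves the cost and, by
      \<open>S'_iff\<close>, the success probability.\<close>
    proof (rule randomised_cc_le[where R = "map_pmf (map_protocol \<rho>) R"])
      show "solves_with_bounded_error (map_pmf (map_protocol \<rho>) R) (nlists n X) (nlists n Y)
          (composed n X Y g S')"
        using R(2) by (simp add: solves_with_bounded_error_def composed_def run_map_protocol S'_iff
            vimage_def)
    qed (use R(1) in \<open>auto simp: cost_map_protocol\<close>)
  qed
  moreover have "c * real (critical_block_sensitivity n S') \<le> real (composed_cc n X Y g S')"
    using nat S' by (auto simp: critical_bs_lower_bound_def)
  ultimately show "c * real (critical_block_sensitivity n S) \<le> real (composed_cc n X Y g S)"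
    using \<open>0 < c\<close> mult_left_mono[of "real (critical_block_sensitivity n S)"
        "real (critical_block_sensitivity n S')" c] by linarith
qed

(* The constants g and c must not depend on the type of solutions, so the existential cannot
   simply be stated polymorphically: the first conjunct provides the gadget and the constant, the
   second says that the same gadget and constant serve solution sets of every type 'q. *)
theorem theorem1:
  shows
    "(\<exists>(X :: nat set) (Y :: nat set) (g :: nat \<Rightarrow> nat \<Rightarrow> bool) (c :: real).
        finite X \<and> finite Y \<and> c > 0 \<and> critical_bs_lower_bound TYPE(nat) X Y g c) \<and>
     (\<forall>(X :: nat set) (Y :: nat set) (g :: nat \<Rightarrow> nat \<Rightarrow> bool) (c :: real).
        finite X \<and> finite Y \<and> c > 0 \<and> critical_bs_lower_bound TYPE(nat) X Y g c \<longrightarrow>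
        critical_bs_lower_bound TYPE('q) X Y g c)"
proof (intro conjI allI impI)
  show "\<exists>(X :: nat set) (Y :: nat set) (g :: nat \<Rightarrow> nat \<Rightarrow> bool) (c :: real).
        finite X \<and> finite Y \<and> c > 0 \<and> critical_bs_lower_bound TYPE(nat) X Y g c"
    using gadget_critical_bs_lower_bound[where 'q = nat]
    by (intro exI[of _ "{..<4}"] exI[of _ gadget] exI[of _ "1 / 6400"]) simp
qed (use critical_bs_lower_bound_transfer in blast)

end
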